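(* Let the diamond graph be the graph on vertices $d_1,d_2,d_3,d_4$ with edges $d_1d_2$, $d_1d_3$, $d_2d_3$, $d_2d_4$, $d_3d_4$ (i.e. $K_4$ minus the edge $d_1d_4$). Let $H$ be the $(d_2,1)$-ordering of the diamond graph. Then $R_<(H)\le 13$.
   Context: A $k$-ordering of a graph $H$ assigns distinct order-labels from $\{1,\ldots,|H|\}$ to $k$ of the vertices of $H$. For a vertex $v$ of $H$ and $1\le l\le |H|$, the $(v,l)$-ordering of $H$ is the 1-ordering in which $v$ receives order-label $l$ and no other vertex is labeled. An ordered 2-coloring on $n$ vertices is a red/blue coloring of the edges of the complete graph on vertex set $\{1,\ldots,n\}$. It contains a $k$-ordering $H$ (in a given color) if it has a subgraph isomorphic to $H$, all of whose edges have that color, such that for every $i$ the $i$-th smallest vertex of the copy corresponds to a vertex of $H$ that has order-label $i$ or no order-label. $R_<(H)$ is the least $n$ such that every ordered 2-coloring on $n$ vertices contains a monochromatic (red or blue) copy of $H$. *)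

theory Defs
  imports Main "HOL-Library.Extended_Nat"
begin

text \<open>A graph (edges are two-element sets of vertices) with a partial assignment of order-labels.\<close>

record 'a labeled_graph =
  vertices :: "'a set"
  edges :: "'a set set"
  order_label :: "'a \<Rightarrow> nat option"

definition k_ordering :: "nat \<Rightarrow> 'a labeled_graph \<Rightarrow> bool" where
  "k_ordering k H \<longleftrightarrow>
     finite (vertices H) \<and>
     edges H \<subseteq> {e. e \<subseteq> vertices H \<and> card e = 2} \<and>
     dom (order_label H) \<subseteq> vertices H \<and>
     card (dom (order_label H)) = k \<and>
     inj_on (order_label H) (dom (order_label H)) \<and>
     ran (order_label H) \<subseteq> {1..card (vertices H)}"

definition vl_ordering :: "'a set \<Rightarrow> 'a set set \<Rightarrow> 'a \<Rightarrow> nat \<Rightarrow> 'a labeled_graph" where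
  "vl_ordering V E v l = \<lparr>vertices = V, edges = E, order_label = [v \<mapsto> l]\<rparr>"

datatype color = Red | Blue

text \<open>
  An ordered 2-coloring on \<open>n\<close> vertices is a function \<open>c :: nat set \<Rightarrow> color\<close>; only its
  values on the two-element subsets of \<open>{1..n}\<close> matter.
\<close>

definition ith_smallest :: "nat set \<Rightarrow> nat \<Rightarrow> nat" where
  "ith_smallest S i = sorted_list_of_set S ! (i - 1)"

text \<open>
  The copy is the image of \<open>H\<close> under the embedding \<open>f\<close>. It is a not necessarily induced
  subgraph: only the images of edges of \<open>H\<close> are required to have color \<open>col\<close>.
\<close>

definition contains_copy :: "nat \<Rightarrow> (nat set \<Rightarrow> color) \<Rightarrow> color \<Rightarrow> 'a labeled_graph \<Rightarrow> bool" where
  "contains_copy n c col H \<longleftrightarrow>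
     (\<exists>f. inj_on f (vertices H) \<and> f ` vertices H \<subseteq> {1..n} \<and>
          (\<forall>e\<in>edges H. c (f ` e) = col) \<and>
          (\<forall>i\<in>{1..card (vertices H)}. \<forall>v\<in>vertices H.
             f v = ith_smallest (f ` vertices H) i \<longrightarrow>
             order_label H v = Some i \<or> order_label H v = None))"

text \<open>The infimum in \<^typ>\<open>enat\<close> is the least such \<open>n\<close>, and \<open>\<infinity>\<close> if there is none.\<close>

definition ordered_ramsey :: "'a labeled_graph \<Rightarrow> enat" where
  "ordered_ramsey H =
     Inf (enat ` {n. \<forall>c. contains_copy n c Red H \<or> contains_copy n c Blue H})"

datatype diamond_vertex = d1 | d2 | d3 | d4

definition diamond_vertices :: "diamond_vertex set" where
  "diamond_vertices = {d1, d2, d3, d4}"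

definition diamond_edges :: "diamond_vertex set set" where
  "diamond_edges = {{d1, d2}, {d1, d3}, {d2, d3}, {d2, d4}, {d3, d4}}"

lemma k_ordering_diamond: "k_ordering 1 (vl_ordering diamond_vertices diamond_edges d2 1)"
  by (auto simp: k_ordering_def vl_ordering_def diamond_vertices_def diamond_edges_def)

end

theory Submission
  imports Defs
begin

text \<open>
  A monochromatic copy is a vertex \<open>a\<close> whose forward neighbourhood in some colour contains a path
  with two edges of that colour. Among ten vertices, the smallest has five forward neighbours in
  one colour, say red. If they span no red path with two edges, then the red edges among them form
  a matching, so the smallest of the five is joined in blue to three of the others, and at least
  two of the three edges among these are blue. Hence even \<open>R\<^sub><(H) \<le> 10\<close>.
\<close>

abbreviation ordered_diamond :: "diamond_vertex labeled_graph" where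
  "ordered_diamond \<equiv> vl_ordering diamond_vertices diamond_edges d2 1"

text \<open>The only order-label in play is 1, so position 1 is the only one that has to be
  recognised. The entries of the sorted list are distinct, and \<open>1 \<le> i\<close> makes the
  truncated \<open>i - 1\<close> vanish only at \<open>i = 1\<close>.\<close>

lemma ith_smallest_eq_Min_iff:
  assumes "finite S" "i \<in> {1..card S}"
  shows "ith_smallest S i = Min S \<longleftrightarrow> i = 1"
proof -
  let ?xs = "sorted_list_of_set S"
  have "S \<noteq> {}" using assms by auto
  then have "Min S = ?xs ! 0"
    using assms(1) by (simp add: sorted_list_of_set_nonempty)
  moreover have "?xs ! (i - 1) = ?xs ! 0 \<longleftrightarrow> i - 1 = 0"
    using assms by (intro nth_eq_iff_index_eq) auto
  ultimately show ?thesis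
    using assms(2) by (auto simp: ith_smallest_def)
qed

text \<open>Here \<open>a\<close> plays \<open>d2\<close>, and \<open>x\<close>, the middle of the
  path \<open>y\<close>, \<open>x\<close>, \<open>z\<close>, plays the other vertex of degree three,
  \<open>d3\<close>. As only \<open>d2\<close> is labelled, the order of \<open>x\<close>,
  \<open>y\<close>, \<open>z\<close> among themselves is free.\<close>

lemma contains_copy_diamondI:
  assumes "{x, y, z} \<subseteq> {a<..n}" "1 \<le> a" "distinct [x, y, z]"
    and "c {a, x} = col" "c {a, y} = col" "c {a, z} = col" "c {x, y} = col" "c {x, z} = col"
  shows "contains_copy n c col ordered_diamond"
proof -
  define f where "f v = (case v of d1 \<Rightarrow> y | d2 \<Rightarrow> a | d3 \<Rightarrow> x | d4 \<Rightarrow> z)" for v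
  have f: "f d1 = y" "f d2 = a" "f d3 = x" "f d4 = z"
    by (simp_all add: f_def)
  have inj: "inj_on f diamond_vertices"
    using assms(1,3) by (auto simp: inj_on_def diamond_vertices_def f)
  have im: "f ` diamond_vertices = {y, a, x, z}"
    by (simp add: diamond_vertices_def f)
  have Min: "Min (f ` diamond_vertices) = a"
    unfolding im using assms(1) by (intro Min_eqI) auto
  have edges: "\<forall>e\<in>diamond_edges. c (f ` e) = col"
    using assms(4-8) by (simp add: diamond_edges_def f insert_commute)
  have range: "f ` diamond_vertices \<subseteq> {1..n}"
    unfolding im using assms(1,2) by auto
  \<comment> \<open>Only \<open>v = d2\<close> matters: its image \<open>a\<close> is the minimum,
    which forces \<open>i = 1\<close>.\<close>
  have label: "[d2 \<mapsto> 1] v = Some i \<or> [d2 \<mapsto> 1] v = None"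
    if "i \<in> {1..card diamond_vertices}" "f v = ith_smallest (f ` diamond_vertices) i" for i v
    using ith_smallest_eq_Min_iff[of "f ` diamond_vertices" i] that Min f card_image[OF inj]
    by (cases v) (simp_all add: im)
  show ?thesis
    unfolding contains_copy_def vl_ordering_def labeled_graph.select_convs
    by (intro exI[of _ f] conjI ballI impI inj range label) (use edges in auto)
qed

text \<open>Keeping the colours \<open>p\<close> and \<open>q\<close> abstract lets one argument
  serve both red and blue stars.\<close>

lemma contains_copy_if_monochromatic_star:
  assumes "V \<subseteq> {a<..n}" "1 \<le> a" "card V \<ge> 5" "\<forall>v\<in>V. c {a, v} = p"
    and pq: "\<And>e. c e \<noteq> p \<Longrightarrow> c e = q"
  shows "contains_copy n c p ordered_diamond \<or> contains_copy n c q ordered_diamond"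
proof (rule ccontr)
  assume no: "\<not> ?thesis"
  have finV: "finite V" and "V \<noteq> {}"
    using assms(3) by (auto intro: card_ge_0_finite)
  define u where "u = Min V"
  have uV: "u \<in> V"
    using finV \<open>V \<noteq> {}\<close> by (simp add: u_def)
  have u_less: "u < v" if "v \<in> V - {u}" for v
    using that finV Min_le[of V v] by (auto simp: u_def order_less_le)
  have no_path: "c {x, y} \<noteq> p \<or> c {x, z} \<noteq> p"
    if "{x, y, z} \<subseteq> V" "distinct [x, y, z]" for x y z
    using no that assms(1,2,4) contains_copy_diamondI[of x y z a n c p] by blast
  define P where "P = {v \<in> V - {u}. c {u, v} = p}"
  define Q where "Q = {v \<in> V - {u}. c {u, v} \<noteq> p}"
  have "finite P" "finite Q"
    using finV by (simp_all add: P_def Q_def)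
  \<comment> \<open>Two such vertices would form a path of colour \<open>p\<close> centred at
    \<open>u\<close>.\<close>
  have "v = w" if "v \<in> P" "w \<in> P" for v w
    using no_path[of u v w] that uV by (auto simp: P_def)
  then have "card P \<le> 1"
    using \<open>finite P\<close> by (simp add: card_le_Suc0_iff_eq)
  moreover have "card P + card Q = card (V - {u})"
    using \<open>finite P\<close> \<open>finite Q\<close>
    by (subst card_Un_disjoint[symmetric]) (auto simp: P_def Q_def intro: arg_cong[where f = card])
  ultimately have "3 \<le> card Q"
    using assms(3) finV uV by simp
  then obtain T where "T \<subseteq> Q" "card T = 3"
    by (meson obtain_subset_with_card_n)
  then obtain x y z where Q: "{x, y, z} \<subseteq> Q" and dist: "distinct [x, y, z]"
    by (auto simp: card_3_iff)
  \<comment> \<open>Now \<open>u\<close> takes over the role of \<open>d2\<close>, being smaller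
    than every vertex of \<open>Q\<close>.\<close>
  have no_q: "c {r, s} = p \<or> c {r, t} = p"
    if "{r, s, t} \<subseteq> Q" "distinct [r, s, t]" for r s t
  proof -
    have "{r, s, t} \<subseteq> {u<..n}" "1 \<le> u"
      using that(1) u_less uV assms(1,2) by (auto simp: Q_def)
    moreover have "c {u, r} = q" "c {u, s} = q" "c {u, t} = q"
      using that(1) pq by (auto simp: Q_def)
    ultimately show ?thesis
      using no that(2) pq contains_copy_diamondI[of r s t u n c q] by blast
  qed
  have V: "{x, y, z} \<subseteq> V"
    using Q by (auto simp: Q_def)
  \<comment> \<open>Any two edges of the triangle \<open>x\<close>, \<open>y\<close>,
    \<open>z\<close> share a vertex. So \<open>no_path\<close> allows at most one edge of colour
    \<open>p\<close> and \<open>no_q\<close> at most one of another colour, but there are three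
    edges.\<close>
  show False
    using no_q[of x y z] no_q[of y x z] no_q[of z x y]
      no_path[of x y z] no_path[of y x z] no_path[of z x y] Q V dist
    by (auto simp: insert_commute)
qed

text \<open>Vertex 1 has nine forward neighbours, the least number for which the pigeonhole
  principle gives five in one colour.\<close>

lemma contains_copy_10:
  "contains_copy 10 c Red ordered_diamond \<or> contains_copy 10 c Blue ordered_diamond"
proof -
  have two_colors: "col = Blue \<longleftrightarrow> col \<noteq> Red" for col
    by (cases col) auto
  define N where "N col = {v \<in> {1<..10::nat}. c {1, v} = col}" for col
  have "N Red \<union> N Blue = {1<..10}"
    by (auto simp: N_def two_colors)
  then have "9 \<le> card (N Red) + card (N Blue)"
    using card_Un_le[of "N Red" "N Blue"] by simp
  then consider "card (N Red) \<ge> 5" | "card (N Blue) \<ge> 5"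
    by linarith
  then show ?thesis
  proof cases
    case 1
    then show ?thesis
      by (intro contains_copy_if_monochromatic_star[where V = "N Red" and a = 1])
        (auto simp: N_def two_colors)
  next
    case 2
    then have "contains_copy 10 c Blue ordered_diamond \<or> contains_copy 10 c Red ordered_diamond"
      by (intro contains_copy_if_monochromatic_star[where V = "N Blue" and a = 1])
        (auto simp: N_def two_colors)
    then show ?thesis by blast
  qed
qed

theorem theorem3p9:
  shows "ordered_ramsey (vl_ordering diamond_vertices diamond_edges d2 1) \<le> 13"
proof -
  have "ordered_ramsey ordered_diamond \<le> enat 10"
    unfolding ordered_ramsey_def using contains_copy_10 by (intro Inf_lower) blast
  also have "enat 10 \<le> 13"
    by (simp add: numeral_eq_enat)
  finally show ?thesis .
qed

end
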